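(* Let $X$ be a metric space, let $K \colon X \times X \to \mathbb{R}$ be a positive-semidefinite kernel with reproducing kernel Hilbert space $H(X)$, and let $(x_i)_{i=1}^\infty$ be a sequence of points in $X$. Suppose that $K(\cdot, x)$ is continuous for every $x \in X$ and that $x \mapsto K(x,x)$ is locally bounded. (i) If for every closed ball $B(x_0, \varepsilon) \subseteq X$ (with $x_0 \in X$, $\varepsilon > 0$) there is a non-trivial function $\psi \in H(X)$ such that $\operatorname{supp}(\psi) \subseteq B(x_0, \varepsilon)$ and $\psi(x_0) \neq 0$, then for every $x \in X$: $\mathrm{err}_n(x) \to 0$ as $n \to \infty$ if and only if $x \in \operatorname{cl}\{x_i\}_{i=1}^\infty$. (ii) If no non-trivial function in $H(X)$ vanishes on a non-empty open set, then $\mathrm{err}_n(x) \to 0$ as $n \to \infty$ for every $x \in X$ whenever $\operatorname{cl}\{x_i\}_{i=1}^\infty$ has non-empty interior.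
   Context: A positive-semidefinite kernel is a symmetric function $K \colon X \times X \to \mathbb{R}$ such that $\sum_{i,j=1}^n c_i c_j K(y_i,y_j) \geq 0$ for all $n$, $y_i \in X$, $c_i \in \mathbb{R}$. Its reproducing kernel Hilbert space (RKHS) $H(X)$ is the unique Hilbert space of functions $f \colon X \to \mathbb{R}$ such that $K(\cdot,x) \in H(X)$ and $\langle f, K(\cdot,x)\rangle_{H(X)} = f(x)$ for all $f \in H(X)$, $x \in X$. The worst-case error at $x \in X$ for the points $x_1,\ldots,x_n$ is $$\mathrm{err}_n(x) = \sup_{0 \neq f \in H(X)} \ \inf_{u_1,\ldots,u_n \in \mathbb{R}} \frac{\lvert f(x) - \sum_{i=1}^n u_i f(x_i)\rvert}{\lVert f \rVert_{H(X)}}.$$ $B(x,\varepsilon)$ denotes the closed ball of radius $\varepsilon$ centered at $x$, $\operatorname{supp}(f)$ is the closure of $\{x : f(x) \neq 0\}$, $\operatorname{cl}$ denotes closure in $X$, and a function is non-trivial if it is not identically zero. *)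

theory Defs
  imports "HOL-Analysis.Analysis"
begin

definition psd_kernel :: "('a \<Rightarrow> 'a \<Rightarrow> real) \<Rightarrow> bool" where
  "psd_kernel K \<longleftrightarrow>
     (\<forall>x y. K x y = K y x) \<and>
     (\<forall>(n::nat) (y :: nat \<Rightarrow> 'a) (c :: nat \<Rightarrow> real).
        (\<Sum>i<n. \<Sum>j<n. c i * c j * K (y i) (y j)) \<ge> 0)"

definition ip_norm :: "(('a \<Rightarrow> real) \<Rightarrow> ('a \<Rightarrow> real) \<Rightarrow> real) \<Rightarrow> ('a \<Rightarrow> real) \<Rightarrow> real" where
  "ip_norm ip f = sqrt (ip f f)"

text \<open>A real Hilbert space whose elements are functions on the type \<open>'a\<close>, with pointwise
  operations. It is given by its carrier \<open>H\<close> and its inner product \<open>ip\<close>; the values of \<open>ip\<close>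
  outside \<open>H\<close> are irrelevant.\<close>

locale hilbert_function_space =
  fixes H :: "('a \<Rightarrow> real) set"
    and ip :: "('a \<Rightarrow> real) \<Rightarrow> ('a \<Rightarrow> real) \<Rightarrow> real"
  assumes zero_mem: "(\<lambda>x. 0) \<in> H"
    and add_mem: "\<lbrakk>f \<in> H; g \<in> H\<rbrakk> \<Longrightarrow> (\<lambda>x. f x + g x) \<in> H"
    and scale_mem: "f \<in> H \<Longrightarrow> (\<lambda>x. a * f x) \<in> H"
    and ip_commute: "\<lbrakk>f \<in> H; g \<in> H\<rbrakk> \<Longrightarrow> ip f g = ip g f"
    and ip_add_left: "\<lbrakk>f \<in> H; g \<in> H; h \<in> H\<rbrakk> \<Longrightarrow> ip (\<lambda>x. f x + g x) h = ip f h + ip g h"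
    and ip_scale_left: "\<lbrakk>f \<in> H; g \<in> H\<rbrakk> \<Longrightarrow> ip (\<lambda>x. a * f x) g = a * ip f g"
    and ip_nonneg: "f \<in> H \<Longrightarrow> ip f f \<ge> 0"
    and ip_definite: "\<lbrakk>f \<in> H; ip f f = 0\<rbrakk> \<Longrightarrow> f = (\<lambda>x. 0)"
    and complete:
      "\<lbrakk>\<And>n::nat. F n \<in> H;
        \<forall>e>0. \<exists>N. \<forall>m\<ge>N. \<forall>n\<ge>N. ip_norm ip (\<lambda>x. F m x - F n x) < e\<rbrakk>
       \<Longrightarrow> \<exists>f\<in>H. (\<lambda>n. ip_norm ip (\<lambda>x. F n x - f x)) \<longlonglongrightarrow> 0"

text \<open>\<open>rkhs H ip K\<close>: the pair \<open>(H, ip)\<close> is the reproducing kernel Hilbert space of \<open>K\<close>. For a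
  positive-semidefinite \<open>K\<close> these conditions determine \<open>H\<close>, and \<open>ip\<close> on \<open>H\<close>, uniquely.\<close>

locale rkhs = hilbert_function_space H ip
  for H :: "('a \<Rightarrow> real) set"
    and ip :: "('a \<Rightarrow> real) \<Rightarrow> ('a \<Rightarrow> real) \<Rightarrow> real" +
  fixes K :: "'a \<Rightarrow> 'a \<Rightarrow> real"
  assumes kernel_mem: "(\<lambda>y. K y x) \<in> H"
    and reproducing: "f \<in> H \<Longrightarrow> ip f (\<lambda>y. K y x) = f x"

text \<open>The worst-case error at \<open>x\<close> for the first \<open>n\<close> points \<open>xs 0, \<dots>, xs (n - 1)\<close>. Only
  \<open>u 0, \<dots>, u (n - 1)\<close> enter the infimum. Taking values in \<open>ennreal\<close> makes the supremum
  over the empty set, which occurs if \<open>H\<close> is trivial, equal to \<open>0\<close>.\<close>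

definition worst_case_err ::
  "('a \<Rightarrow> real) set \<Rightarrow> (('a \<Rightarrow> real) \<Rightarrow> ('a \<Rightarrow> real) \<Rightarrow> real) \<Rightarrow> (nat \<Rightarrow> 'a) \<Rightarrow> nat \<Rightarrow> 'a \<Rightarrow> ennreal" where
  "worst_case_err H ip xs n x =
     (SUP f \<in> {f \<in> H. f \<noteq> (\<lambda>y. 0)}. INF u :: nat \<Rightarrow> real.
        ennreal (\<bar>f x - (\<Sum>i<n. u i * f (xs i))\<bar> / ip_norm ip f))"

definition supp :: "('a::topological_space \<Rightarrow> real) \<Rightarrow> 'a set" where
  "supp f = closure {x. f x \<noteq> 0}"

definition locally_bounded :: "('a::topological_space \<Rightarrow> real) \<Rightarrow> bool" where
  "locally_bounded g \<longleftrightarrow> (\<forall>x. \<exists>U. open U \<and> x \<in> U \<and> bounded (g ` U))"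

end

theory Submission imports Defs begin

text \<open>In \<open>worst_case_err\<close> the weights may depend on \<open>f\<close>, so the infimum is \<open>0\<close> unless \<open>f\<close> vanishes at
  the first \<open>n\<close> points, and then it is \<open>\<bar>f x\<bar> / \<parallel>f\<parallel>\<close>. Hence a function vanishing at all points but
  not at \<open>x\<close> keeps the error away from \<open>0\<close>. Conversely, if the error does not tend to \<open>0\<close>, the
  convex sets \<open>{f \<in> H. f x = 1, f (x\<^sub>i) = 0 for i < n}\<close> contain elements of uniformly bounded norm; by
  the parallelogram law their nearly minimal elements form a Cauchy sequence, and its limit vanishes
  at all points but not at \<open>x\<close>. Therefore the error tends to \<open>0\<close> iff every \<open>f \<in> H\<close> vanishing on the
  sequence vanishes at \<open>x\<close>. Both claims follow since all elements of \<open>H\<close> are continuous: the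
  continuous elements form a closed subspace containing every \<open>K(\<cdot>, x)\<close>.\<close>

section \<open>Inner products, almost minimal elements and bounds on the error\<close>

context hilbert_function_space
begin

lemma diff_scale_mem: "f \<in> H \<Longrightarrow> g \<in> H \<Longrightarrow> (\<lambda>x. f x - a * g x) \<in> H"
  using add_mem[OF _ scale_mem, of f g "-a"] by simp

lemma diff_mem: "f \<in> H \<Longrightarrow> g \<in> H \<Longrightarrow> (\<lambda>x. f x - g x) \<in> H"
  using diff_scale_mem[of f g 1] by simp

lemma ip_scale_scale:
  assumes "f \<in> H"
  shows "ip (\<lambda>x. a * f x) (\<lambda>x. a * f x) = a\<^sup>2 * ip f f"
  using assms by (simp add: ip_scale_left ip_commute[OF assms scale_mem] scale_mem power2_eq_square)

lemma ip_add_scale: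
  assumes "f \<in> H" "g \<in> H"
  shows "ip (\<lambda>x. f x + a * g x) (\<lambda>x. f x + a * g x) = ip f f + 2 * a * ip f g + a\<^sup>2 * ip g g"
proof -
  have ag: "(\<lambda>x. a * g x) \<in> H" and fg: "(\<lambda>x. f x + a * g x) \<in> H"
    using assms add_mem scale_mem by auto
  have "ip h (\<lambda>x. f x + a * g x) = ip h f + a * ip h g" if "h \<in> H" for h
    using that assms ag fg ip_add_left[OF assms(1) ag that] ip_scale_left[OF assms(2) that]
    by (metis ip_commute)
  then show ?thesis
    using assms ip_add_left[OF assms(1) ag fg] ip_scale_left[OF assms(2) fg] ip_commute[OF assms]
    by (simp add: power2_eq_square algebra_simps)
qed

lemma ip_diff_scale:
  assumes "f \<in> H" "g \<in> H"
  shows "ip (\<lambda>x. f x - a * g x) (\<lambda>x. f x - a * g x) = ip f f - 2 * a * ip f g + a\<^sup>2 * ip g g"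
  using ip_add_scale[OF assms, of "-a"] by simp

text \<open>The parallelogram law with the midpoint singled out: in a convex set the midpoint
  competes for minimal norm, so almost minimal elements are close to each other.\<close>

lemma parallelogram_midpoint:
  assumes "f \<in> H" "g \<in> H"
  shows "ip (\<lambda>x. f x - g x) (\<lambda>x. f x - g x)
    = 2 * ip f f + 2 * ip g g - 4 * ip (\<lambda>x. (f x + g x) / 2) (\<lambda>x. (f x + g x) / 2)"
  using ip_diff_scale[OF assms, of 1] ip_add_scale[OF assms, of 1]
    ip_scale_scale[OF add_mem[OF assms], of "1/2"]
  by (simp add: power2_eq_square)

lemma Cauchy_Schwarz:
  assumes "f \<in> H" "g \<in> H"
  shows "(ip f g)\<^sup>2 \<le> ip f f * ip g g"
proof (cases "ip g g = 0")
  case True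
  then have "g = (\<lambda>x. 0 * g x)" using ip_definite[OF assms(2)] by auto
  then have "ip g f = 0" using ip_scale_left[OF assms(2,1), of 0] by simp
  then show ?thesis using True ip_commute[OF assms] by simp
next
  case False
  then have pos: "ip g g > 0" using ip_nonneg[OF assms(2)] by simp
  \<comment> \<open>The square norm of \<open>f\<close> minus its projection onto \<open>g\<close>
    is non-negative.\<close>
  have "0 \<le> ip f f - (ip f g)\<^sup>2 / ip g g"
    using ip_nonneg[OF diff_scale_mem[OF assms, of "ip f g / ip g g"]] False
    unfolding ip_diff_scale[OF assms] by (simp add: power2_eq_square)
  then show ?thesis using pos by (simp add: field_simps)
qed

lemma ip_norm_pos: "f \<in> H \<Longrightarrow> f \<noteq> (\<lambda>x. 0) \<Longrightarrow> ip_norm ip f > 0"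
  using ip_definite ip_nonneg unfolding ip_norm_def by (force simp: order_less_le)

text \<open>Applied to sets of functions vanishing at more and more points, and to a constant
  sequence of sets for an orthogonal projection. The sets may fail to be closed, so the limit
  \<open>f\<close> is only placed in \<open>H\<close>.\<close>

lemma nested_convex_almost_minimizers:
  assumes sub: "\<And>n. C n \<subseteq> H"
    and dec: "decseq C"
    and mid: "\<And>n. \<forall>f\<in>C n. \<forall>g\<in>C n. (\<lambda>x. (f x + g x) / 2) \<in> C n"
    and bound: "\<And>n. \<exists>f\<in>C n. ip f f \<le> B"
  shows "\<exists>F. \<exists>f\<in>H. (\<forall>n. F n \<in> C n)
    \<and> (\<forall>n. \<forall>g\<in>C n. ip (F n) (F n) \<le> ip g g + 1 / (real n + 1))
    \<and> (\<lambda>n. ip_norm ip (\<lambda>x. F n x - f x)) \<longlonglongrightarrow> 0"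
proof -
  \<comment> \<open>The infimum of the square norms on \<open>C n\<close>. It grows as the sets
    shrink and stays below \<open>B\<close>, hence converges.\<close>
  define d where "d n = (INF f\<in>C n. ip f f)" for n
  have sub_C: "C n \<subseteq> C m" if "m \<le> n" for m n using decseqD[OF dec that] .
  have ne: "C n \<noteq> {}" for n using bound[of n] by auto
  have bdd: "bdd_below ((\<lambda>f. ip f f) ` C n)" for n
    using sub ip_nonneg by (intro bdd_belowI[of _ 0]) blast
  have d_le: "d n \<le> ip f f" if "f \<in> C n" for n f
    unfolding d_def using bdd that by (rule cINF_lower)
  have "incseq d"
    unfolding incseq_def d_def using sub_C ne bdd by (auto intro!: cINF_superset_mono)
  moreover have "d n \<le> B" for n using bound[of n] d_le by fastforce
  ultimately obtain L where L: "d \<longlonglongrightarrow> L" and dL: "\<And>n. d n \<le> L"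
    using incseq_convergent by metis
  have "\<exists>f\<in>C n. ip f f < d n + 1 / (real n + 1)" for n
    using cINF_less_iff[OF ne bdd, of n "d n + 1 / (real n + 1)"] unfolding d_def[symmetric] by simp
  then obtain F where F: "\<And>n. F n \<in> C n" and Fd: "\<And>n. ip (F n) (F n) < d n + 1 / (real n + 1)"
    by metis
  have FH: "F n \<in> H" for n using F sub by blast
  \<comment> \<open>The value of \<open>2 * a + 2 * b - 4 * c\<close> in the parallelogram law for
    \<open>a = b = L + 1 / (n + 1)\<close> and \<open>c = d n\<close>.\<close>
  define r where "r n = 4 * (L - d n) + 4 * (1 / (real n + 1))" for n
  have "r \<longlonglongrightarrow> 4 * (L - L) + 4 * 0"
    unfolding r_def divide_inverse using LIMSEQ_inverse_real_of_nat
    by (intro tendsto_intros L) (simp add: add.commute)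
  then have r0: "r \<longlonglongrightarrow> 0" by simp
  have close: "ip (\<lambda>x. F m x - F n x) (\<lambda>x. F m x - F n x) \<le> r N" if "N \<le> m" "N \<le> n" for m n N
  proof -
    \<comment> \<open>Both functions lie in \<open>C N\<close>, so their midpoint does too and has
      square norm at least \<open>d N\<close>.\<close>
    have "(\<lambda>x. (F m x + F n x) / 2) \<in> C N" using mid F sub_C that by blast
    then have lower: "d N \<le> ip (\<lambda>x. (F m x + F n x) / 2) (\<lambda>x. (F m x + F n x) / 2)" by (rule d_le)
    have upper: "ip (F k) (F k) \<le> L + 1 / (real N + 1)" if "N \<le> k" for k
    proof -
      have "1 / (real k + 1) \<le> 1 / (real N + 1)" using that by (simp add: frac_le)
      then show ?thesis using Fd[of k] dL[of k] by linarith
    qed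
    have "2 * a + 2 * b - 4 * c \<le> 4 * (L - d N) + 4 * \<delta>"
      if "d N \<le> c" "a \<le> L + \<delta>" "b \<le> L + \<delta>" for a b c \<delta> :: real
      using that by simp
    from this[OF lower upper[OF that(1)] upper[OF that(2)]] show ?thesis
      unfolding r_def parallelogram_midpoint[OF FH FH] .
  qed
  have Cauchy: "\<forall>e>0. \<exists>N. \<forall>m\<ge>N. \<forall>n\<ge>N. ip_norm ip (\<lambda>x. F m x - F n x) < e"
  proof (intro allI impI)
    fix e :: real assume "e > 0"
    have "\<forall>\<^sub>F n in sequentially. r n < e\<^sup>2" using order_tendstoD(2)[OF r0] \<open>e > 0\<close> by simp
    then obtain N where "r N < e\<^sup>2" by (auto simp: eventually_sequentially)
    then have "ip_norm ip (\<lambda>x. F m x - F n x) < e" if "m \<ge> N" "n \<ge> N" for m n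
      unfolding ip_norm_def using close[OF that] \<open>e > 0\<close> by (simp add: real_less_lsqrt)
    then show "\<exists>N. \<forall>m\<ge>N. \<forall>n\<ge>N. ip_norm ip (\<lambda>x. F m x - F n x) < e" by blast
  qed
  obtain f where "f \<in> H" "(\<lambda>n. ip_norm ip (\<lambda>x. F n x - f x)) \<longlonglongrightarrow> 0"
    using complete[OF FH Cauchy] by (elim bexE) (rule that)
  moreover have "ip (F n) (F n) \<le> ip g g + 1 / (real n + 1)" if "g \<in> C n" for n g
    using Fd[of n] d_le[OF that] by linarith
  ultimately show ?thesis using F by blast
qed

text \<open>A function whose infimum exceeds \<open>e\<close> must vanish at the points; zero
  weights then give \<open>e * ip_norm ip f < \<bar>f x\<bar>\<close>, and division by
  \<open>f x\<close> normalises the value at \<open>x\<close>.\<close>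

lemma worst_case_err_witness:
  assumes "e > 0" "ennreal e < worst_case_err H ip xs n x"
  obtains f where "f \<in> H" "\<And>i. i < n \<Longrightarrow> f (xs i) = 0" "f x = 1" "ip f f \<le> 1 / e\<^sup>2"
proof -
  obtain f where f: "f \<in> H" "f \<noteq> (\<lambda>y. 0)" and
    less: "ennreal e < (INF u. ennreal (\<bar>f x - (\<Sum>i<n. u i * f (xs i))\<bar> / ip_norm ip f))"
    using assms(2) unfolding worst_case_err_def less_SUP_iff by blast
  have less_u: "e < \<bar>f x - (\<Sum>i<n. u i * f (xs i))\<bar> / ip_norm ip f" for u :: "nat \<Rightarrow> real"
    using less_le_trans[OF less INF_lower[OF UNIV_I, of _ u]] assms(1) by (simp add: ennreal_less_iff)
  have zero: "f (xs i) = 0" if "i < n" for i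
  proof (rule ccontr)
    assume "f (xs i) \<noteq> 0"
    \<comment> \<open>A single weight \<open>f x / f (xs i)\<close> at index \<open>i\<close>
      reproduces \<open>f x\<close> exactly and makes the error \<open>0\<close>.\<close>
    moreover have "(\<Sum>j<n. (if j = i then f x / f (xs i) else 0) * f (xs j))
        = (\<Sum>j<n. if j = i then f x / f (xs i) * f (xs i) else 0)"
      by (rule sum.cong) auto
    ultimately show False
      using less_u[of "\<lambda>j. if j = i then f x / f (xs i) else 0"] that assms(1) by simp
  qed
  have "ip_norm ip f > 0" using ip_norm_pos f by blast
  then have le: "e * ip_norm ip f < \<bar>f x\<bar>" using less_u[of "\<lambda>_. 0"] by (simp add: field_simps)
  then have fx: "f x \<noteq> 0" using assms(1) \<open>ip_norm ip f > 0\<close> by (auto simp: zero_less_mult_iff dest: order.asym)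
  have "(e * ip_norm ip f)\<^sup>2 \<le> \<bar>f x\<bar>\<^sup>2"
    using le assms(1) \<open>ip_norm ip f > 0\<close> by (intro power_mono) auto
  then have "e\<^sup>2 * ip f f \<le> (f x)\<^sup>2"
    using ip_nonneg[OF f(1)] by (simp add: power_mult_distrib ip_norm_def)
  then have "ip (\<lambda>y. (1 / f x) * f y) (\<lambda>y. (1 / f x) * f y) \<le> 1 / e\<^sup>2"
    unfolding ip_scale_scale[OF f(1)] using fx assms(1) by (simp add: field_simps)
  then show thesis using that[OF scale_mem[OF f(1)], of "1 / f x"] zero fx by simp
qed

text \<open>When \<open>f\<close> vanishes at the points, the weights have no influence: every term
  of the infimum is the same quotient.\<close>

lemma worst_case_err_ge:
  assumes "f \<in> H" "f \<noteq> (\<lambda>y. 0)" "\<And>i. i < n \<Longrightarrow> f (xs i) = 0"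
  shows "ennreal (\<bar>f x\<bar> / ip_norm ip f) \<le> worst_case_err H ip xs n x"
proof -
  have "ennreal (\<bar>f x\<bar> / ip_norm ip f)
      \<le> (INF u :: nat \<Rightarrow> real. ennreal (\<bar>f x - (\<Sum>i<n. u i * f (xs i))\<bar> / ip_norm ip f))"
    using assms(3) by (intro INF_greatest) simp
  also have "\<dots> \<le> worst_case_err H ip xs n x"
    unfolding worst_case_err_def using assms(1,2) by (intro SUP_upper) simp
  finally show ?thesis .
qed

end

section \<open>Point evaluation and the criterion for the error to tend to zero\<close>

context rkhs
begin

text \<open>Cauchy-Schwarz for \<open>f\<close> and \<open>\<lambda>y. K y x\<close>, whose square
  norm is \<open>K x x\<close>.\<close>

lemma abs_le_ip_norm:
  assumes "f \<in> H"
  shows "\<bar>f x\<bar> \<le> ip_norm ip f * sqrt (K x x)"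
proof -
  have "(f x)\<^sup>2 \<le> ip f f * K x x"
    using Cauchy_Schwarz[OF assms kernel_mem[of x]] by (simp add: reproducing assms kernel_mem)
  then have "sqrt ((f x)\<^sup>2) \<le> sqrt (ip f f * K x x)" by (rule real_sqrt_le_mono)
  then show ?thesis by (simp add: ip_norm_def real_sqrt_mult)
qed

lemma norm_limit_imp_pointwise:
  assumes "\<And>n. F n \<in> H" "f \<in> H" "(\<lambda>n. ip_norm ip (\<lambda>x. F n x - f x)) \<longlonglongrightarrow> 0"
  shows "(\<lambda>n. F n x) \<longlonglongrightarrow> f x"
proof -
  have "(\<lambda>n. ip_norm ip (\<lambda>x. F n x - f x) * sqrt (K x x)) \<longlonglongrightarrow> 0"
    using tendsto_mult_left_zero[OF assms(3)] .
  then have "(\<lambda>n. F n x - f x) \<longlonglongrightarrow> 0"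
    by (rule Lim_null_comparison[rotated]) (simp add: abs_le_ip_norm[OF diff_mem[OF assms(1,2)]])
  then show ?thesis by (simp add: LIM_zero_iff)
qed

lemma worst_case_err_tendsto_0_iff:
  "(\<lambda>n. worst_case_err H ip xs n x) \<longlonglongrightarrow> 0 \<longleftrightarrow> (\<forall>f\<in>H. (\<forall>i. f (xs i) = 0) \<longrightarrow> f x = 0)"
proof
  assume lim: "(\<lambda>n. worst_case_err H ip xs n x) \<longlonglongrightarrow> 0"
  show "\<forall>f\<in>H. (\<forall>i. f (xs i) = 0) \<longrightarrow> f x = 0"
  proof (intro ballI impI, rule ccontr)
    fix f assume f: "f \<in> H" "\<forall>i. f (xs i) = 0" "f x \<noteq> 0"
    then have ne: "f \<noteq> (\<lambda>y. 0)" by auto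
    \<comment> \<open>The quotient bounds the error from below for all \<open>n\<close> alike, so
      the bound passes to the limit.\<close>
    have "ennreal (\<bar>f x\<bar> / ip_norm ip f) \<le> 0"
      using worst_case_err_ge[OF f(1) ne] f(2) by (intro LIMSEQ_le_const[OF lim]) auto
    moreover have "\<bar>f x\<bar> / ip_norm ip f > 0" using ip_norm_pos[OF f(1) ne] f(3) by simp
    ultimately show False by (simp add: ennreal_eq_0_iff)
  qed
next
  assume van: "\<forall>f\<in>H. (\<forall>i. f (xs i) = 0) \<longrightarrow> f x = 0"
  show "(\<lambda>n. worst_case_err H ip xs n x) \<longlonglongrightarrow> 0"
  proof (rule order_tendstoI)
    fix a :: ennreal assume "0 < a"
    show "\<forall>\<^sub>F n in sequentially. worst_case_err H ip xs n x < a"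
    proof (rule ccontr)
      assume "\<not> ?thesis"
      then have large: "\<exists>m\<ge>n. a \<le> worst_case_err H ip xs m x" for n
        by (auto simp: eventually_sequentially not_less)
      \<comment> \<open>\<open>a\<close> may be infinite; a value strictly below it is finite and
        hence given by a real.\<close>
      obtain z where z: "0 < z" "z < a" using dense[OF \<open>0 < a\<close>] by blast
      then obtain e where "z = ennreal e" by (cases z) auto
      then have e: "0 < e" "ennreal e < a" using z by auto
      define C where "C n = {f \<in> H. (\<forall>i<n. f (xs i) = 0) \<and> f x = 1}" for n
      have bound: "\<exists>f\<in>C n. ip f f \<le> 1 / e\<^sup>2" for n
      proof -
        \<comment> \<open>The error is known to be large only for some \<open>m \<ge> n\<close>;
          this suffices, as vanishing at the first \<open>m\<close> points includes the first
          \<open>n\<close>.\<close>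
        obtain m where "m \<ge> n" "a \<le> worst_case_err H ip xs m x" using large by blast
        then have "ennreal (e) < worst_case_err H ip xs m x" using e(2) by simp
        from worst_case_err_witness[OF e(1) this] obtain f where "f \<in> H"
          "\<And>i. i < m \<Longrightarrow> f (xs i) = 0" "f x = 1" "ip f f \<le> 1 / e\<^sup>2" by blast
        then show ?thesis using \<open>m \<ge> n\<close> unfolding C_def by (intro bexI[of _ f]) auto
      qed
      have mid: "\<forall>f\<in>C n. \<forall>g\<in>C n. (\<lambda>x. (f x + g x) / 2) \<in> C n" for n
        using scale_mem[OF add_mem, of _ _ "1/2"] by (auto simp: C_def)
      have sub: "C n \<subseteq> H" for n by (auto simp: C_def)
      have dec: "decseq C" by (auto simp: C_def decseq_def)
      obtain F f where f: "f \<in> H" and F: "\<forall>n. F n \<in> C n"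
        and lim: "(\<lambda>n. ip_norm ip (\<lambda>x. F n x - f x)) \<longlonglongrightarrow> 0"
        using nested_convex_almost_minimizers[OF sub dec mid bound]
        by (elim exE bexE conjE) (rule that)
      have pt: "(\<lambda>n. F n y) \<longlonglongrightarrow> f y" for y
        using F by (intro norm_limit_imp_pointwise[OF _ f lim]) (auto simp: C_def)
      \<comment> \<open>\<open>F n\<close> is known to vanish at \<open>xs i\<close> once
        \<open>n > i\<close>, which is enough for the limit.\<close>
      have "f (xs i) = 0" for i
      proof (rule LIMSEQ_unique[OF pt tendsto_eventually])
        show "\<forall>\<^sub>F n in sequentially. F n (xs i) = 0"
          using F by (intro eventually_mono[OF eventually_gt_at_top[of i]]) (auto simp: C_def)
      qed
      moreover have "f x = 1"
        using F by (intro LIMSEQ_unique[OF pt[of x]]) (simp add: C_def)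
      ultimately show False using van f by force
    qed
  qed simp
qed

end

section \<open>Continuity of all elements of the space\<close>

lemma rkhs_norm_limit_continuous:
  fixes K :: "'a::t2_space \<Rightarrow> 'a \<Rightarrow> real"
  assumes "rkhs H ip K" and bdd: "locally_bounded (\<lambda>x. K x x)"
    and F: "\<And>n. F n \<in> H" "\<And>n. continuous_on UNIV (F n)"
    and f: "f \<in> H" and lim: "(\<lambda>n. ip_norm ip (\<lambda>x. F n x - f x)) \<longlonglongrightarrow> 0"
  shows "continuous_on UNIV f"
proof -
  interpret rkhs H ip K by fact
  have "isCont f x" for x
  proof -
    obtain U where U: "open U" "x \<in> U" "bounded ((\<lambda>x. K x x) ` U)"
      using bdd unfolding locally_bounded_def by blast
    then obtain B where B: "\<And>y. y \<in> U \<Longrightarrow> K y y \<le> B"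
      unfolding bounded_iff by (auto simp: abs_le_iff)
    \<comment> \<open>One bound for all of \<open>U\<close>: since \<open>K y y\<close> is at most
      \<open>B\<close> there, norm convergence becomes uniform convergence near
      \<open>x\<close>.\<close>
    have bound: "\<bar>F n y - f y\<bar> \<le> ip_norm ip (\<lambda>x. F n x - f x) * sqrt B" if "y \<in> U" for n y
      using abs_le_ip_norm[OF diff_mem[OF F(1) f], of n y] B[OF that]
        ip_nonneg[OF diff_mem[OF F(1) f], of n]
      by (elim order_trans) (auto simp: ip_norm_def intro!: mult_left_mono)
    have lim_U: "uniform_limit U F f sequentially"
    proof (rule uniform_limitI)
      fix e :: real assume "e > 0"
      then have "\<forall>\<^sub>F n in sequentially. ip_norm ip (\<lambda>x. F n x - f x) * sqrt B < e"
        by (rule order_tendstoD(2)[OF tendsto_mult_left_zero[OF lim]])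
      then show "\<forall>\<^sub>F n in sequentially. \<forall>y\<in>U. dist (F n y) (f y) < e"
        by (rule eventually_mono) (use bound in \<open>auto simp: dist_real_def intro: le_less_trans\<close>)
    qed
    have "\<forall>\<^sub>F n in sequentially. continuous_on U (F n)"
      using continuous_on_subset[OF F(2)] by simp
    then have "continuous_on U f" using lim_U by (rule uniform_limit_theorem) simp
    then show ?thesis using U continuous_on_eq_continuous_at by blast
  qed
  then show ?thesis by (simp add: continuous_at_imp_continuous_on)
qed

text \<open>Subtracting from \<open>f\<close> its projection \<open>g\<close> to the continuous elements leaves a function orthogonal
  to every \<open>K(\<cdot>, x)\<close>, so \<open>f = g\<close>.\<close>

lemma rkhs_mem_continuous:
  fixes K :: "'a::t2_space \<Rightarrow> 'a \<Rightarrow> real"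
  assumes "rkhs H ip K" and cont: "\<And>x. continuous_on UNIV (\<lambda>y. K y x)"
    and bdd: "locally_bounded (\<lambda>x. K x x)" and f: "f \<in> H"
  shows "continuous_on UNIV f"
proof -
  interpret rkhs H ip K by fact
  \<comment> \<open>All differences of \<open>f\<close> and a continuous element of
    \<open>H\<close>; the almost minimal ones tend to the residual \<open>h\<close> of
    \<open>f\<close> after projection.\<close>
  define C where "C = {h \<in> H. continuous_on UNIV (\<lambda>x. f x - h x)}"
  have mid: "\<forall>g\<in>C. \<forall>h\<in>C. (\<lambda>x. (g x + h x) / 2) \<in> C"
  proof (intro ballI)
    fix g h assume that: "g \<in> C" "h \<in> C"
    have "continuous_on UNIV (\<lambda>x. ((f x - g x) + (f x - h x)) / 2)"
      using that unfolding C_def by (intro continuous_on_divide continuous_on_add) auto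
    moreover have "(\<lambda>x. ((f x - g x) + (f x - h x)) / 2) = (\<lambda>x. f x - (g x + h x) / 2)"
      by (simp add: field_simps)
    ultimately have "continuous_on UNIV (\<lambda>x. f x - (g x + h x) / 2)" by metis
    then show "(\<lambda>x. (g x + h x) / 2) \<in> C"
      using that scale_mem[OF add_mem, of g h "1/2"] by (simp add: C_def)
  qed
  have bound: "\<exists>g\<in>C. ip g g \<le> ip f f" using f by (auto simp: C_def intro!: bexI[of _ f])
  have sub: "C \<subseteq> H" by (auto simp: C_def)
  obtain F h where h: "h \<in> H" and F: "\<forall>n. F n \<in> C"
    and min: "\<forall>n. \<forall>g\<in>C. ip (F n) (F n) \<le> ip g g + 1 / (real n + 1)"
    and lim: "(\<lambda>n. ip_norm ip (\<lambda>x. F n x - h x)) \<longlonglongrightarrow> 0"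
    using nested_convex_almost_minimizers[OF sub decseq_const mid bound]
    by (elim exE bexE conjE) (rule that)
  have FH: "F n \<in> H" for n using F by (simp add: C_def)
  have "h x = 0" for x
  proof -
    \<comment> \<open>Subtracting \<open>t * K y x\<close> from \<open>F n\<close> stays within
      \<open>C\<close>, so almost minimality gives the inequality up to \<open>1 / (n + 1)\<close>,
      which disappears in the limit.\<close>
    have quad: "2 * t * h x \<le> t\<^sup>2 * K x x" for t
    proof -
      have "2 * t * F n x \<le> t\<^sup>2 * K x x + inverse (real (Suc n))" for n
      proof -
        have "continuous_on UNIV (\<lambda>y. (f y - F n y) + t * K y x)"
          using F cont unfolding C_def by (intro continuous_on_add continuous_on_mult_left) auto
        then have "(\<lambda>y. F n y - t * K y x) \<in> C"
          using diff_scale_mem[OF FH kernel_mem] by (simp add: C_def algebra_simps)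
        from bspec[OF spec[OF min, of n] this] show ?thesis
          by (simp add: ip_diff_scale[OF FH kernel_mem] reproducing FH kernel_mem
              inverse_eq_divide add.commute)
      qed
      moreover have "(\<lambda>n. 2 * t * F n x) \<longlonglongrightarrow> 2 * t * h x"
        by (intro tendsto_intros norm_limit_imp_pointwise[OF FH h lim])
      moreover have "(\<lambda>n. t\<^sup>2 * K x x + inverse (real (Suc n))) \<longlonglongrightarrow> t\<^sup>2 * K x x + 0"
        by (intro tendsto_intros LIMSEQ_inverse_real_of_nat)
      ultimately have "2 * t * h x \<le> t\<^sup>2 * K x x + 0" by (intro LIMSEQ_le) auto
      then show ?thesis by simp
    qed
    have K0: "K x x \<ge> 0"
      using ip_nonneg[OF kernel_mem[of x]] reproducing[OF kernel_mem[of x], of x] by simp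
    \<comment> \<open>With \<open>t = h x / k\<close> the inequality forces \<open>h x = 0\<close>;
      the added \<open>1\<close> keeps the denominator positive even if
      \<open>K x x = 0\<close>.\<close>
    define k where "k = K x x + 1"
    have k: "k > 0" "K x x = k - 1" using K0 by (auto simp: k_def)
    have "2 * (h x)\<^sup>2 * k = 2 * (h x / k) * h x * k\<^sup>2" using k(1) by (simp add: power2_eq_square)
    also have "\<dots> \<le> (h x / k)\<^sup>2 * (k - 1) * k\<^sup>2"
      using quad[of "h x / k"] unfolding k(2) by (rule mult_right_mono) simp
    also have "\<dots> = (h x)\<^sup>2 * (k - 1)" using k(1) by (simp add: power2_eq_square)
    finally have "(h x)\<^sup>2 * (k + 1) \<le> 0" by (simp add: algebra_simps)
    then show ?thesis using k(1) by (simp add: mult_le_0_iff)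
  qed
  then have h0: "(\<lambda>x. f x - h x) = f" by simp
  \<comment> \<open>Thus \<open>f\<close> is the norm limit of the continuous functions
    \<open>f - F n\<close>, whose difference from \<open>f - h\<close> is
    \<open>-(F n - h)\<close>.\<close>
  have lim': "(\<lambda>n. ip_norm ip (\<lambda>x. (f x - F n x) - (f x - h x))) \<longlonglongrightarrow> 0"
  proof -
    have "ip_norm ip (\<lambda>x. (f x - F n x) - (f x - h x)) = ip_norm ip (\<lambda>x. F n x - h x)" for n
      using ip_scale_scale[OF diff_mem[OF FH h], of "-1" n] by (simp add: ip_norm_def)
    then show ?thesis using lim by simp
  qed
  have "continuous_on UNIV (\<lambda>x. f x - h x)"
    by (rule rkhs_norm_limit_continuous[OF assms(1) bdd diff_mem[OF f FH] _ diff_mem[OF f h] lim'])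
      (use F in \<open>simp add: C_def\<close>)
  then show ?thesis unfolding h0 .
qed

section \<open>Passage to the closure of the points, and the two claims\<close>

lemma continuous_zero_on_closure:
  fixes f :: "'a::topological_space \<Rightarrow> real"
  assumes "continuous_on UNIV f" "\<And>y. y \<in> S \<Longrightarrow> f y = 0" "x \<in> closure S"
  shows "f x = 0"
  using continuous_constant_on_closure[of S f 0 x] continuous_on_subset[OF assms(1)] assms(2,3)
  by simp

theorem theorem1p1:
  fixes K :: "'a::metric_space \<Rightarrow> 'a \<Rightarrow> real"
    and H :: "('a \<Rightarrow> real) set"
    and ip :: "('a \<Rightarrow> real) \<Rightarrow> ('a \<Rightarrow> real) \<Rightarrow> real"
    and xs :: "nat \<Rightarrow> 'a"
  assumes "psd_kernel K"
    and "rkhs H ip K"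
    and "\<And>x. continuous_on UNIV (\<lambda>y. K y x)"
    and "locally_bounded (\<lambda>x. K x x)"
  shows "((\<forall>x0 \<epsilon>. \<epsilon> > 0 \<longrightarrow>
             (\<exists>\<psi>\<in>H. \<psi> \<noteq> (\<lambda>y. 0) \<and> supp \<psi> \<subseteq> cball x0 \<epsilon> \<and> \<psi> x0 \<noteq> 0)) \<longrightarrow>
          (\<forall>x. (\<lambda>n. worst_case_err H ip xs n x) \<longlonglongrightarrow> 0 \<longleftrightarrow> x \<in> closure (range xs)))
       \<and> ((\<forall>f\<in>H. f \<noteq> (\<lambda>y. 0) \<longrightarrow>
             \<not> (\<exists>U. open U \<and> U \<noteq> {} \<and> (\<forall>y\<in>U. f y = 0))) \<longrightarrow>
          interior (closure (range xs)) \<noteq> {} \<longrightarrow>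
          (\<forall>x. (\<lambda>n. worst_case_err H ip xs n x) \<longlonglongrightarrow> 0))"
proof -
  interpret rkhs H ip K by fact
  note err_iff = worst_case_err_tendsto_0_iff[of xs]
  have van: "f x = 0" if "f \<in> H" "\<forall>i. f (xs i) = 0" "x \<in> closure (range xs)" for f x
    by (rule continuous_zero_on_closure[OF rkhs_mem_continuous[OF assms(2-4) that(1)] _ that(3)])
      (use that(2) in auto)
  show ?thesis
  proof (intro conjI impI allI)
    fix x
    assume bump: "\<forall>x0 \<epsilon>. \<epsilon> > 0 \<longrightarrow>
      (\<exists>\<psi>\<in>H. \<psi> \<noteq> (\<lambda>y. 0) \<and> supp \<psi> \<subseteq> cball x0 \<epsilon> \<and> \<psi> x0 \<noteq> 0)"
    show "(\<lambda>n. worst_case_err H ip xs n x) \<longlonglongrightarrow> 0 \<longleftrightarrow> x \<in> closure (range xs)"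
    proof
      assume err: "(\<lambda>n. worst_case_err H ip xs n x) \<longlonglongrightarrow> 0"
      show "x \<in> closure (range xs)"
      proof (rule ccontr)
        assume "x \<notin> closure (range xs)"
        \<comment> \<open>A bump supported in a ball that avoids the closure vanishes at every
          \<open>xs i\<close> but not at the centre \<open>x\<close>, against the criterion.\<close>
        then obtain \<epsilon> where \<epsilon>: "\<epsilon> > 0" "cball x \<epsilon> \<subseteq> - closure (range xs)"
          using open_contains_cball[of "- closure (range xs)"] by auto
        then obtain \<psi> where \<psi>: "\<psi> \<in> H" "supp \<psi> \<subseteq> cball x \<epsilon>" "\<psi> x \<noteq> 0" using bump by blast
        have "\<psi> (xs i) = 0" for i
        proof (rule ccontr)
          assume "\<psi> (xs i) \<noteq> 0"
          then have "xs i \<in> supp \<psi>" unfolding supp_def by (intro subsetD[OF closure_subset]) simp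
          moreover have "xs i \<in> closure (range xs)" by (intro subsetD[OF closure_subset]) simp
          ultimately show False using \<psi>(2) \<epsilon>(2) by blast
        qed
        then show False using err \<psi> by (auto simp: err_iff)
      qed
    next
      assume "x \<in> closure (range xs)"
      then show "(\<lambda>n. worst_case_err H ip xs n x) \<longlonglongrightarrow> 0" using van by (auto simp: err_iff)
    qed
  next
    fix x
    assume uniq: "\<forall>f\<in>H. f \<noteq> (\<lambda>y. 0) \<longrightarrow> \<not> (\<exists>U. open U \<and> U \<noteq> {} \<and> (\<forall>y\<in>U. f y = 0))"
      and ne: "interior (closure (range xs)) \<noteq> {}"
    have "f x = 0" if f: "f \<in> H" "\<forall>i. f (xs i) = 0" for f
    proof -
      \<comment> \<open>Vanishing on the sequence spreads to its closure and so holds on a non-empty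
        open set, where \<open>uniq\<close> applies.\<close>
      have "\<forall>y\<in>interior (closure (range xs)). f y = 0" using van f interior_subset by blast
      then have "f = (\<lambda>y. 0)" using uniq f(1) ne open_interior by blast
      then show ?thesis by simp
    qed
    then show "(\<lambda>n. worst_case_err H ip xs n x) \<longlonglongrightarrow> 0" by (auto simp: err_iff)
  qed
qed

end
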